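(* Let $0<H<\frac12$, let $\sigma>0$ and $Z_0>0$ be constants, and let $(W_t^H)_{t\ge0}$ be a fractional Brownian motion with Hurst parameter $H$. Let $f_k:[0,\infty)\times[0,\infty)\to(-\infty,+\infty)$, $k\in\mathbb{N}$, be a sequence of continuous functions such that each $f_k$ satisfies conditions (D1) and (D2) (stated in the context), and such that for each point $(t,z)\in[0,\infty)\times[0,\infty)$, $$f_k(t,z)\le f_{k+1}(t,z)\ \text{ for all } k\in\mathbb{N}\quad\text{and}\quad\lim_{k\to\infty}f_k(t,z)=\infty.$$ For each $k$, let $(Z_t^{(k)})_{t\ge0}$ be the stochastic process given by $$Z_t^{(k)}=\begin{cases}Z_0+\displaystyle\int_0^t\frac12 f_k(s,Z_s^{(k)})\left(Z_s^{(k)}\right)^{-1}ds+\frac{\sigma}{2}W_t^H & \text{if } t<\tau^{(k)}(\omega),\\[2mm] 0&\text{otherwise,}\end{cases}$$ where $\tau^{(k)}(\omega)=\inf\{t\ge0: Z_t^{(k)}(\omega)=0\}$. Then for any $T>0$, $$\mathbb{P}\left(\tau^{(k)}(\omega)>T\right)\to1\quad\text{as } k\to\infty.$$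
   Context: Condition (D1) on a function $f:[0,\infty)\times[0,\infty)\to\mathbb R$: the function $g:[0,\infty)\times(0,\infty)\to(-\infty,\infty)$ defined by $g(t,x)=f(t,x)/(2x)$ is continuous and admits a continuous partial derivative with respect to $x$ on $(0,\infty)$; in addition, there exists a number $x^*>0$ (which may depend on $f$) such that for every $x>x^*$, $g(t,x)<0$ for all $t\ge 0$. Condition (D2) on $f$: for any $T>0$ there exists $x_T>0$ (which may depend on $f$) such that $f(t,x)>0$ for all $0<t\le T$ and $0\le x\le x_T$. The fractional Brownian motion starts at $W_0^H=0$ and has almost surely continuous sample paths; the same $W^H$ and the same $Z_0$ are used for every $k$. Under (D1), for each $k$ the equation for $Z^{(k)}$ has, pathwise almost surely, a unique solution which is continuous and positive up to the time $\tau^{(k)}$ of its first visit to $0$ (with $\inf\emptyset=+\infty$); $Z^{(k)}$ denotes this solution, set equal to $0$ from time $\tau^{(k)}$ on. *)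

theory Defs
  imports "HOL-Probability.Probability"
begin

text \<open>Constants count as (degenerate) Gaussian random variables.\<close>

definition gaussian_rv :: "'a measure \<Rightarrow> ('a \<Rightarrow> real) \<Rightarrow> bool" where
  "gaussian_rv M X \<longleftrightarrow>
     (\<exists>\<mu> s. 0 < s \<and> distributed M lborel X (\<lambda>x. ennreal (normal_density \<mu> s x))) \<or>
     (\<exists>c. X \<in> borel_measurable M \<and> (AE \<omega> in M. X \<omega> = c))"

definition gaussian_process :: "'a measure \<Rightarrow> (real \<Rightarrow> 'a \<Rightarrow> real) \<Rightarrow> bool" where
  "gaussian_process M W \<longleftrightarrow>
     (\<forall>S c. finite S \<and> S \<subseteq> {0..} \<longrightarrow> gaussian_rv M (\<lambda>\<omega>. \<Sum>t\<in>S. c t * W t \<omega>))"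

definition fractional_brownian_motion :: "'a measure \<Rightarrow> real \<Rightarrow> (real \<Rightarrow> 'a \<Rightarrow> real) \<Rightarrow> bool" where
  "fractional_brownian_motion M H W \<longleftrightarrow>
     (\<forall>t\<ge>0. W t \<in> borel_measurable M) \<and>
     gaussian_process M W \<and>
     (\<forall>t\<ge>0. (\<integral>\<omega>. W t \<omega> \<partial>M) = 0) \<and>
     (\<forall>s\<ge>0. \<forall>t\<ge>0. (\<integral>\<omega>. W s \<omega> * W t \<omega> \<partial>M) =
        (s powr (2 * H) + t powr (2 * H) - \<bar>t - s\<bar> powr (2 * H)) / 2) \<and>
     (AE \<omega> in M. W 0 \<omega> = 0) \<and>
     (AE \<omega> in M. continuous_on {0..} (\<lambda>t. W t \<omega>))"

text \<open>Functions on \<open>[0,\<infinity>) \<times> [0,\<infinity>)\<close> are total functions whose values outside the quadrant are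
  never used. In \<open>cond_D1\<close>, \<open>g'\<close> is the partial derivative in \<open>x\<close>; it is required to be jointly
  continuous in \<open>(t,x)\<close>.\<close>

definition cond_D1 :: "(real \<Rightarrow> real \<Rightarrow> real) \<Rightarrow> bool" where
  "cond_D1 f \<longleftrightarrow>
     (let g = (\<lambda>t x. f t x / (2 * x)) in
       continuous_on ({0..} \<times> {0<..}) (\<lambda>(t, x). g t x) \<and>
       (\<exists>g'. (\<forall>t\<ge>0. \<forall>x>0. (g t has_real_derivative g' t x) (at x)) \<and>
             continuous_on ({0..} \<times> {0<..}) (\<lambda>(t, x). g' t x)) \<and>
       (\<exists>xstar>0. \<forall>x>xstar. \<forall>t\<ge>0. g t x < 0))"

definition cond_D2 :: "(real \<Rightarrow> real \<Rightarrow> real) \<Rightarrow> bool" where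
  "cond_D2 f \<longleftrightarrow>
     (\<forall>T>0. \<exists>xT>0. \<forall>t x. 0 < t \<and> t \<le> T \<and> 0 \<le> x \<and> x \<le> xT \<longrightarrow> 0 < f t x)"

text \<open>The infimum is taken in the extended reals, so it is \<open>\<infinity>\<close> if there is no zero.\<close>

definition first_zero :: "(real \<Rightarrow> real) \<Rightarrow> ereal" where
  "first_zero z = Inf {ereal t | t. 0 \<le> t \<and> z t = 0}"

text \<open>The path \<open>z\<close> solves the integral equation driven by the path \<open>w\<close>. The initial condition
  excludes the zero path, which has \<open>first_zero z = 0\<close>. Continuity is required up to and including
  the first zero; otherwise a solution cut off to \<open>0\<close> by a jump at an arbitrary time would qualify.
  For \<open>t\<close> before the first zero the integrand is continuous on \<open>[0,t]\<close> if \<open>f\<close> is, so the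
  integral exists.\<close>

definition is_solution_path ::
    "(real \<Rightarrow> real \<Rightarrow> real) \<Rightarrow> real \<Rightarrow> real \<Rightarrow> (real \<Rightarrow> real) \<Rightarrow> (real \<Rightarrow> real) \<Rightarrow> bool" where
  "is_solution_path f \<sigma> z0 w z \<longleftrightarrow>
     z 0 = z0 \<and>
     continuous_on {t. 0 \<le> t \<and> ereal t \<le> first_zero z} z \<and>
     (\<forall>t\<ge>0. ereal t < first_zero z \<longrightarrow> 0 < z t) \<and>
     (\<forall>t\<ge>0. z t =
        (if ereal t < first_zero z
         then z0 + integral {0..t} (\<lambda>s. 1 / 2 * f s (z s) * inverse (z s)) + \<sigma> / 2 * w t
         else 0))"

end

theory Submission
  imports Defs
begin

text \<open>The argument works path by path: for almost every \<open>\<omega>\<close> there is an index, depending on \<open>\<omega>\<close>,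
  after which no \<open>\<tau>\<^sup>(\<^sup>k\<^sup>)\<close> lies in \<open>[0,T]\<close>.

  The reason is a race between the noise and the drift. Suppose a solution reaches \<open>0\<close> at a time
  \<open>\<tau> \<le> T\<close>, and let \<open>L < \<tau>\<close> be the last time at which it is at its initial level \<open>z\<^sub>0\<close>. On
  \<open>[L, \<tau>)\<close> the solution stays in \<open>(0, z\<^sub>0]\<close>, so if \<open>f \<ge> c \<ge> 0\<close> on \<open>[0,T] \<times> [0,z\<^sub>0]\<close>, the drift is at
  least \<open>c / (2 z\<^sub>0)\<close> there, and
  \<open>- z\<^sub>0 \<ge> c / (2 z\<^sub>0) * (\<tau> - L) + \<sigma> / 2 * (w \<tau> - w L)\<close>.
  The noise alone cannot produce a drop of \<open>z\<^sub>0\<close> within a time shorter than some \<open>\<delta> > 0\<close>, by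
  uniform continuity of \<open>w\<close> on \<open>[0,T]\<close>; and over a time of at least \<open>\<delta>\<close> the drift gains
  \<open>c \<delta> / (2 z\<^sub>0)\<close>, which outweighs the bounded noise once \<open>c\<close> is large. The threshold for \<open>c\<close> depends
  on the noise path but not on \<open>f\<close> (\<open>large_drift_delays_first_zero\<close>).

  An increasing sequence of continuous functions that diverges pointwise diverges uniformly on a
  compact set, by the covering argument of Dini's theorem
  (\<open>monotone_divergence_uniform_on_compact\<close>). Hence \<open>f\<^sub>k\<close> eventually exceeds the threshold of
  almost every noise path. Almost sure eventual non-extinction gives convergence of the
  probabilities by dominated convergence; since a solution is positive at time \<open>T\<close> exactly if it has
  not been absorbed by then, the event agrees almost surely with the measurable event
  \<open>Z\<^sup>(\<^sup>k\<^sup>)\<^sub>T > 0\<close>.\<close>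

section \<open>Uniform divergence on compact sets\<close>

text \<open>The sets where \<open>f k > c\<close> form an increasing open cover of \<open>K\<close>, so one of them is all of \<open>K\<close>.\<close>

lemma monotone_divergence_uniform_on_compact:
  fixes f :: "nat \<Rightarrow> 'a::topological_space \<Rightarrow> real"
  assumes "compact K"
    and cont: "\<And>k. continuous_on K (f k)"
    and incr: "\<And>k x. x \<in> K \<Longrightarrow> f k x \<le> f (Suc k) x"
    and lim: "\<And>x. x \<in> K \<Longrightarrow> filterlim (\<lambda>k. f k x) at_top sequentially"
  shows "\<forall>\<^sub>F k in sequentially. \<forall>x\<in>K. c \<le> f k x"
proof -
  have "\<exists>A. open A \<and> A \<inter> K = f k -` {c<..} \<inter> K" for k
    using cont[of k] open_greaterThan[of c] unfolding continuous_on_open_invariant by blast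
  then obtain A where A: "\<And>k. open (A k)" "\<And>k. A k \<inter> K = f k -` {c<..} \<inter> K"
    by metis
  have "K \<subseteq> (\<Union>k. A k)"
  proof
    fix x assume x: "x \<in> K"
    have "\<forall>\<^sub>F k in sequentially. c < f k x"
      using lim[OF x] by (simp add: filterlim_at_top_dense)
    then obtain k where "c < f k x"
      using eventually_happens'[OF sequentially_bot] by blast
    then show "x \<in> (\<Union>k. A k)" using A(2)[of k] x by blast
  qed
  then obtain D where D: "finite D" "K \<subseteq> (\<Union>k\<in>D. A k)"
    using compactE_image[OF \<open>compact K\<close>, of UNIV A] A(1) by (metis subset_UNIV)
  have mono: "f m x \<le> f n x" if "x \<in> K" "m \<le> n" for m n x
    by (rule lift_Suc_mono_le[of "\<lambda>k. f k x"]) (use incr that in auto)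
  have "c \<le> f k x" if "Max (insert 0 D) \<le> k" "x \<in> K" for k x
  proof -
    obtain d where d: "d \<in> D" "x \<in> A d" using D \<open>x \<in> K\<close> by blast
    then have "c < f d x" using A(2)[of d] \<open>x \<in> K\<close> by blast
    moreover have "d \<le> k" using that(1) d(1) D(1) by simp
    ultimately show ?thesis using mono[OF \<open>x \<in> K\<close>] by (meson less_imp_le order_trans)
  qed
  then show ?thesis unfolding eventually_sequentially by blast
qed

section \<open>Extinction of a single path\<close>

lemma solution_path_continuous:
  assumes "is_solution_path f \<sigma> z0 w z"
  shows "continuous_on {t. 0 \<le> t \<and> ereal t \<le> first_zero z} z"
  using assms unfolding is_solution_path_def by blast

lemma solution_path_positive_iff:
  assumes "is_solution_path f \<sigma> z0 w z" "0 \<le> t"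
  shows "0 < z t \<longleftrightarrow> ereal t < first_zero z"
  using assms unfolding is_solution_path_def by (metis less_irrefl)

text \<open>The infimum defining the first zero is attained, because a solution path vanishes from that
  time on.\<close>

lemma solution_path_first_zero_attained:
  assumes sol: "is_solution_path f \<sigma> z0 w z" and "0 < z0"
    and "\<not> ereal T < first_zero z"
  obtains \<tau> where "first_zero z = ereal \<tau>" "0 < \<tau>" "\<tau> \<le> T" "z \<tau> = 0"
proof -
  have "0 \<le> first_zero z"
    unfolding first_zero_def by (rule Inf_greatest) auto
  moreover have "first_zero z \<le> ereal T" using assms(3) by simp
  ultimately obtain \<tau> where \<tau>: "first_zero z = ereal \<tau>" "0 \<le> \<tau>" "\<tau> \<le> T"
    by (cases "first_zero z") auto
  have "z \<tau> = 0" using sol \<tau> unfolding is_solution_path_def by auto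
  moreover have "\<tau> \<noteq> 0"
    using \<open>z \<tau> = 0\<close> sol \<open>0 < z0\<close> unfolding is_solution_path_def by auto
  ultimately show thesis using that \<tau> by simp
qed

lemma solution_path_increment:
  assumes sol: "is_solution_path f \<sigma> z0 w z"
    and contf: "continuous_on ({0..} \<times> {0..}) (\<lambda>(t, x). f t x)"
    and "0 \<le> s" "s \<le> t" "ereal t < first_zero z"
  shows "(\<lambda>u. 1 / 2 * f u (z u) * inverse (z u)) integrable_on {s..t}"
    and "z t - z s =
      integral {s..t} (\<lambda>u. 1 / 2 * f u (z u) * inverse (z u)) + \<sigma> / 2 * (w t - w s)"
proof -
  let ?G = "\<lambda>u. 1 / 2 * f u (z u) * inverse (z u)"
  have before: "ereal u < first_zero z" if "u \<le> t" for u
    using that assms(5) by (meson ereal_less_eq(3) le_less_trans)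
  have pos: "0 < z u" if "0 \<le> u" "u \<le> t" for u
    using solution_path_positive_iff[OF sol that(1)] before[OF that(2)] by simp
  have contz: "continuous_on {0..t} z"
    by (rule continuous_on_subset[OF solution_path_continuous[OF sol]])
      (use before in \<open>auto simp: less_imp_le\<close>)
  have "continuous_on {0..t} (\<lambda>u. (\<lambda>(t, x). f t x) (u, z u))"
    by (rule continuous_on_compose2[OF contf])
      (use contz pos in \<open>auto intro!: continuous_intros simp: less_imp_le\<close>)
  then have "continuous_on {0..t} ?G"
    using contz pos by (auto intro!: continuous_intros simp: less_le)
  then have int: "?G integrable_on {0..t}" by (rule integrable_continuous_real)
  then show "?G integrable_on {s..t}"
    by (rule integrable_on_subinterval) (use \<open>0 \<le> s\<close> in auto)
  have eq: "z u = z0 + integral {0..u} ?G + \<sigma> / 2 * w u" if "0 \<le> u" "u \<le> t" for u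
    using sol before[OF that(2)] that(1) unfolding is_solution_path_def by presburger
  have "integral {0..s} ?G + integral {s..t} ?G = integral {0..t} ?G"
    by (rule Henstock_Kurzweil_Integration.integral_combine) (use assms int in auto)
  then show "z t - z s = integral {s..t} ?G + \<sigma> / 2 * (w t - w s)"
    using eq[of t] eq[of s] assms(3,4) unfolding right_diff_distrib by linarith
qed

text \<open>The balance between drift and noise on the final descent, from the last visit to the level
  \<open>z0\<close> down to \<open>0\<close>. The integral equation is available only before the first zero \<open>\<tau>\<close>, where the
  integrand may be unbounded, so the inequality is first obtained for times \<open>t < \<tau>\<close> and then passed
  to the limit by continuity.\<close>

lemma final_descent_inequality:
  assumes sol: "is_solution_path f \<sigma> z0 w z" and "0 < z0" "0 \<le> c"
    and contf: "continuous_on ({0..} \<times> {0..}) (\<lambda>(t, x). f t x)"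
    and contw: "continuous_on {0..} w"
    and \<tau>: "first_zero z = ereal \<tau>" "0 < \<tau>" "z \<tau> = 0"
    and lower: "\<And>t x. 0 \<le> t \<Longrightarrow> t \<le> \<tau> \<Longrightarrow> 0 \<le> x \<Longrightarrow> x \<le> z0 \<Longrightarrow> c \<le> f t x"
  obtains L where "0 \<le> L" "L < \<tau>"
    "c / (2 * z0) * (\<tau> - L) + \<sigma> / 2 * (w \<tau> - w L) \<le> - z0"
proof -
  let ?G = "\<lambda>u. 1 / 2 * f u (z u) * inverse (z u)"
  have contz: "continuous_on {0..\<tau>} z"
    by (rule continuous_on_subset[OF solution_path_continuous[OF sol]]) (use \<tau> in auto)
  have z0: "z 0 = z0" using sol by (simp add: is_solution_path_def)
  define S where "S = {0..\<tau>} \<inter> z -` {z0..}"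
  have "closed S" unfolding S_def
    by (intro continuous_closed_preimage contz) auto
  moreover have "bounded S" unfolding S_def by (meson bounded_closed_interval bounded_subset inf_le1)
  ultimately have "compact S" by (simp add: compact_eq_bounded_closed)
  moreover have "0 \<in> S" using z0 \<tau> by (simp add: S_def)
  then have "S \<noteq> {}" by blast
  ultimately obtain L where "L \<in> S" and last: "\<And>t. t \<in> S \<Longrightarrow> t \<le> L"
    using compact_attains_sup[of S] by metis
  then have L: "0 \<le> L" "L \<le> \<tau>" "z0 \<le> z L" by (auto simp: S_def)
  then have "L < \<tau>" using \<tau> \<open>0 < z0\<close> by (cases "L = \<tau>") auto
  have "z L = z0"
  proof -
    have "continuous_on {L..\<tau>} z" using contz L by (auto elim: continuous_on_subset)
    then obtain x where x: "L \<le> x" "x \<le> \<tau>" "z x = z0"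
      using IVT2'[of z \<tau> z0 L] L \<tau> \<open>0 < z0\<close> by auto
    then have "x \<le> L" using last[of x] L by (auto simp: S_def)
    then show ?thesis using x by simp
  qed
  have below: "z u \<le> z0" if "L \<le> u" "u \<le> \<tau>" for u
    using last[of u] that L \<open>z L = z0\<close> by (cases "u = L") (force simp: S_def)+
  have drift: "c / (2 * z0) \<le> ?G u" if "L \<le> u" "u < \<tau>" for u
  proof -
    have "0 < z u" using solution_path_positive_iff[OF sol, of u] that L \<tau> by simp
    moreover have "z u \<le> z0" using below that by simp
    moreover have "c \<le> f u (z u)" using lower calculation that L by simp
    ultimately have "c / (2 * z0) \<le> f u (z u) / (2 * z u)"
      using \<open>0 \<le> c\<close> by (intro frac_le) auto
    then show ?thesis by (simp add: field_simps)
  qed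
  have early: "c / (2 * z0) * (t - L) + \<sigma> / 2 * (w t - w L) \<le> z t - z0" if "t \<in> {L..<\<tau>}" for t
  proof -
    have t: "L \<le> t" "ereal t < first_zero z" using that \<tau> by auto
    note inc = solution_path_increment[OF sol contf L(1) t]
    have "integral {L..t} (\<lambda>u. c / (2 * z0)) \<le> integral {L..t} ?G"
      by (rule integral_le) (use inc(1) drift that in auto)
    then show ?thesis using inc(2) \<open>z L = z0\<close> t by (simp add: mult.commute)
  qed
  have "\<tau> \<in> closure {L..<\<tau>}" using \<open>L < \<tau>\<close> by simp
  let ?h = "\<lambda>t. c / (2 * z0) * (t - L) + \<sigma> / 2 * (w t - w L) - z t"
  have "continuous_on (closure {L..<\<tau>}) ?h"
    using \<open>L < \<tau>\<close> L(1) \<open>0 < z0\<close>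
    by (auto intro!: continuous_intros continuous_on_subset[OF contz] continuous_on_subset[OF contw])
  then have "?h \<tau> \<le> - z0"
    using \<open>\<tau> \<in> closure {L..<\<tau>}\<close>
    by (rule continuous_le_on_closure) (use early in \<open>simp add: algebra_simps\<close>)
  then show thesis using that \<open>0 \<le> L\<close> \<open>L < \<tau>\<close> \<tau>(3) by simp
qed

lemma large_drift_delays_first_zero:
  fixes w :: "real \<Rightarrow> real"
  assumes contw: "continuous_on {0..} w" and "0 < \<sigma>" "0 < z0"
  obtains c where "\<And>f z. is_solution_path f \<sigma> z0 w z \<Longrightarrow>
      continuous_on ({0..} \<times> {0..}) (\<lambda>(t, x). f t x) \<Longrightarrow>
      (\<And>t x. 0 \<le> t \<Longrightarrow> t \<le> T \<Longrightarrow> 0 \<le> x \<Longrightarrow> x \<le> z0 \<Longrightarrow> c \<le> f t x) \<Longrightarrow>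
      ereal T < first_zero z"
proof -
  have contT: "continuous_on {0..T} w" using contw by (rule continuous_on_subset) auto
  have "bounded (w ` {0..T})"
    by (intro compact_imp_bounded compact_continuous_image contT) auto
  then obtain B where B: "0 < B" "\<And>t. t \<in> {0..T} \<Longrightarrow> \<bar>w t\<bar> \<le> B"
    unfolding bounded_pos by auto
  have "uniformly_continuous_on {0..T} w"
    by (intro compact_uniformly_continuous contT) auto
  moreover have "0 < 2 * z0 / \<sigma>" using assms by simp
  ultimately obtain \<delta> where \<delta>: "0 < \<delta>"
    "\<And>s t. s \<in> {0..T} \<Longrightarrow> t \<in> {0..T} \<Longrightarrow> dist t s < \<delta> \<Longrightarrow> dist (w t) (w s) < 2 * z0 / \<sigma>"
    unfolding uniformly_continuous_on_def by metis
  \<comment> \<open>With this choice the drift gains \<open>\<sigma> * B\<close> over a time \<open>\<delta>\<close>, and the noise term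
     \<open>\<sigma> / 2 * (w t - w s)\<close> loses at most as much.\<close>
  define c where "c = 2 * z0 * \<sigma> * B / \<delta>"
  have "0 \<le> c" unfolding c_def using assms B \<delta> by simp
  have "ereal T < first_zero z"
    if sol: "is_solution_path f \<sigma> z0 w z"
      and contf: "continuous_on ({0..} \<times> {0..}) (\<lambda>(t, x). f t x)"
      and lower: "\<And>t x. 0 \<le> t \<Longrightarrow> t \<le> T \<Longrightarrow> 0 \<le> x \<Longrightarrow> x \<le> z0 \<Longrightarrow> c \<le> f t x" for f z
  proof (rule ccontr)
    assume "\<not> ereal T < first_zero z"
    then obtain \<tau> where \<tau>: "first_zero z = ereal \<tau>" "0 < \<tau>" "\<tau> \<le> T" "z \<tau> = 0"
      using solution_path_first_zero_attained[OF sol \<open>0 < z0\<close>] by blast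
    obtain L where L: "0 \<le> L" "L < \<tau>"
      and descent: "c / (2 * z0) * (\<tau> - L) + \<sigma> / 2 * (w \<tau> - w L) \<le> - z0"
      using final_descent_inequality[OF sol \<open>0 < z0\<close> \<open>0 \<le> c\<close> contf contw \<tau>(1,2,4)] lower \<tau>(3)
      by (metis order_trans)
    have mem: "L \<in> {0..T}" "\<tau> \<in> {0..T}" using L \<tau> by auto
    show False
    proof (cases "\<tau> - L < \<delta>")
      case True
      then have "\<bar>w \<tau> - w L\<bar> < 2 * z0 / \<sigma>"
        using \<delta>(2)[OF mem] L by (simp add: dist_real_def)
      then have "- (2 * z0 / \<sigma>) < w \<tau> - w L" by linarith
      then have "\<sigma> / 2 * - (2 * z0 / \<sigma>) < \<sigma> / 2 * (w \<tau> - w L)"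
        using \<open>0 < \<sigma>\<close> by (intro mult_strict_left_mono) auto
      then have "- z0 < \<sigma> / 2 * (w \<tau> - w L)" using \<open>0 < \<sigma>\<close> by simp
      moreover have "0 \<le> c / (2 * z0) * (\<tau> - L)" using \<open>0 \<le> c\<close> \<open>0 < z0\<close> L by simp
      ultimately show False using descent by linarith
    next
      case False
      then have "c / (2 * z0) * \<delta> \<le> c / (2 * z0) * (\<tau> - L)"
        using \<open>0 \<le> c\<close> \<open>0 < z0\<close> by (intro mult_left_mono) auto
      moreover have "c / (2 * z0) * \<delta> = \<sigma> * B"
        unfolding c_def using \<open>0 < z0\<close> \<delta>(1) by simp
      moreover have "\<sigma> / 2 * (- 2 * B) \<le> \<sigma> / 2 * (w \<tau> - w L)"
        using B(2)[OF mem(1)] B(2)[OF mem(2)] \<open>0 < \<sigma>\<close> by (intro mult_left_mono) auto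
      ultimately show False using descent \<open>0 < z0\<close> by simp
    qed
  qed
  then show thesis using that by blast
qed

section \<open>Convergence of the survival probabilities\<close>

text \<open>Passing from almost sure eventual occurrence to probabilities. An event such as non-extinction
  restricts a whole path and is known only to agree almost surely with a measurable \<open>E k\<close>, so its
  probability is taken in the completion.\<close>

lemma (in prob_space) eventually_AE_imp_prob_tendsto_1:
  fixes P :: "nat \<Rightarrow> 'a \<Rightarrow> bool"
  assumes meas: "\<And>k. E k \<in> sets M"
    and AE_eq: "\<And>k. AE \<omega> in M. \<omega> \<in> E k \<longleftrightarrow> P k \<omega>"
    and ev: "AE \<omega> in M. \<forall>\<^sub>F k in sequentially. P k \<omega>"
  shows "(\<lambda>k. measure (completion M) {\<omega> \<in> space M. P k \<omega>}) \<longlonglongrightarrow> 1"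
proof -
  have prob_eq: "measure (completion M) {\<omega> \<in> space M. P k \<omega>} = prob (E k)" for k
  proof -
    let ?A = "{\<omega> \<in> space M. P k \<omega>}"
    have "AE \<omega> in completion M. (\<omega> \<in> E k) = (\<omega> \<in> ?A)"
      using AE_completion[OF AE_eq[of k]] AE_space[of "completion M"] by eventually_elim auto
    moreover from this have "?A \<in> sets (completion M)"
      by (rule completion.in_sets_AE) (use meas[of k] in auto)
    ultimately have "measure (completion M) (E k) = measure (completion M) ?A"
      using meas by (intro measure_eq_AE) auto
    then show ?thesis using meas by simp
  qed
  have "AE \<omega> in M. (\<lambda>k. indicat_real (E k) \<omega>) \<longlonglongrightarrow> 1"
  proof -
    have "AE \<omega> in M. \<forall>k. \<omega> \<in> E k \<longleftrightarrow> P k \<omega>" using AE_eq by (simp add: AE_all_countable)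
    with ev show ?thesis
    proof eventually_elim
      case (elim \<omega>)
      have "\<forall>\<^sub>F k in sequentially. indicat_real (E k) \<omega> = 1"
        using elim(1) by eventually_elim (use elim(2) in auto)
      then show ?case by (rule tendsto_eventually)
    qed
  qed
  then have "(\<lambda>k. \<integral>\<omega>. indicat_real (E k) \<omega> \<partial>M) \<longlonglongrightarrow> (\<integral>\<omega>. 1 \<partial>M)"
    by (intro integral_dominated_convergence[where w = "\<lambda>_. 1"])
      (use meas in \<open>auto simp: indicator_def\<close>)
  then show ?thesis using meas by (simp add: prob_eq prob_space)
qed

(* The solution property only holds almost surely, so on an incomplete space the event in the
   conclusion is measurable only up to a null set; hence the completion of M. *)
theorem theorem5p1:
  fixes M :: "'a measure"
    and W :: "real \<Rightarrow> 'a \<Rightarrow> real"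
    and f :: "nat \<Rightarrow> real \<Rightarrow> real \<Rightarrow> real"
    and Z :: "nat \<Rightarrow> real \<Rightarrow> 'a \<Rightarrow> real"
    and H \<sigma> Z0 T :: real
  assumes "prob_space M"
    and "0 < H" and "H < 1 / 2"
    and "0 < \<sigma>" and "0 < Z0"
    and "fractional_brownian_motion M H W"
    and "\<And>k. continuous_on ({0..} \<times> {0..}) (\<lambda>(t, z). f k t z)"
    and "\<And>k. cond_D1 (f k)"
    and "\<And>k. cond_D2 (f k)"
    and "\<And>k t z. 0 \<le> t \<Longrightarrow> 0 \<le> z \<Longrightarrow> f k t z \<le> f (Suc k) t z"
    and "\<And>t z. 0 \<le> t \<Longrightarrow> 0 \<le> z \<Longrightarrow> filterlim (\<lambda>k. f k t z) at_top sequentially"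
    and "\<And>k t. 0 \<le> t \<Longrightarrow> Z k t \<in> borel_measurable M"
    and "\<And>k. AE \<omega> in M. is_solution_path (f k) \<sigma> Z0 (\<lambda>t. W t \<omega>) (\<lambda>t. Z k t \<omega>)"
    and "0 < T"
  shows "(\<lambda>k. measure (completion M) {\<omega> \<in> space M. ereal T < first_zero (\<lambda>t. Z k t \<omega>)})
           \<longlonglongrightarrow> 1"
proof -
  interpret prob_space M by fact
  have contw: "AE \<omega> in M. continuous_on {0..} (\<lambda>t. W t \<omega>)"
    using assms(6) by (simp add: fractional_brownian_motion_def)
  have sol: "AE \<omega> in M. \<forall>k. is_solution_path (f k) \<sigma> Z0 (\<lambda>t. W t \<omega>) (\<lambda>t. Z k t \<omega>)"
    using assms(13) by (simp add: AE_all_countable)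
  have large: "\<forall>\<^sub>F k in sequentially. \<forall>p\<in>{0..T} \<times> {0..Z0}. c \<le> (\<lambda>(t, x). f k t x) p" for c
    by (rule monotone_divergence_uniform_on_compact)
      (use assms(10,11) in
        \<open>auto intro!: compact_Times continuous_on_subset[OF assms(7)]\<close>)
  show ?thesis
  proof (rule eventually_AE_imp_prob_tendsto_1)
    show "{\<omega> \<in> space M. 0 < Z k T \<omega>} \<in> sets M" for k
      using assms(12)[of T k] \<open>0 < T\<close> by simp
    show "AE \<omega> in M. \<omega> \<in> {\<omega> \<in> space M. 0 < Z k T \<omega>} \<longleftrightarrow> ereal T < first_zero (\<lambda>t. Z k t \<omega>)" for k
      using assms(13)[of k] AE_space
    proof eventually_elim
      case (elim \<omega>)
      then show ?case using solution_path_positive_iff[OF elim(1), of T] \<open>0 < T\<close> by simp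
    qed
    show "AE \<omega> in M. \<forall>\<^sub>F k in sequentially. ereal T < first_zero (\<lambda>t. Z k t \<omega>)"
      using contw sol
    proof eventually_elim
      case (elim \<omega>)
      obtain c where c: "\<And>g z. is_solution_path g \<sigma> Z0 (\<lambda>t. W t \<omega>) z \<Longrightarrow>
          continuous_on ({0..} \<times> {0..}) (\<lambda>(t, x). g t x) \<Longrightarrow>
          (\<And>t x. 0 \<le> t \<Longrightarrow> t \<le> T \<Longrightarrow> 0 \<le> x \<Longrightarrow> x \<le> Z0 \<Longrightarrow> c \<le> g t x) \<Longrightarrow>
          ereal T < first_zero z"
        using large_drift_delays_first_zero[OF elim(1) \<open>0 < \<sigma>\<close> \<open>0 < Z0\<close>] by metis
      show ?case
        using large[of c]
        by eventually_elim (rule c[OF elim(2)[rule_format] assms(7)], auto)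
    qed
  qed
qed

end
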